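(* Let $\mathbf{A}$ be a commutative $\ell$-bimonoid, let $\mathbf{A}^{\Delta}$ be its commutative complemented Dedekind--MacNeille completion (regarded as a commutative involutive residuated lattice), and let $\Pi$ be a set of positive universal clauses in the signature $\{\vee,\cdot,1\}$. Then the following are equivalent: (i) $\mathbf{A}^{\Delta}$ satisfies $\Pi$; (ii) $\mathbf{A}$ is a subreduct of a commutative involutive residuated lattice satisfying $\Pi$; (iii) for each $\pi\in\Pi$, $\mathbf{A}$ is a subreduct of a commutative involutive residuated lattice satisfying $\pi$.
   Context: A commutative $\ell$-bimonoid $\langle A,\vee,\wedge,\cdot,1,+,0\rangle$ is a lattice with two commutative monoid operations $\cdot$ (unit $1$) and $+$ (unit $0$) such that $x\cdot(y\vee z)=(x\cdot y)\vee(x\cdot z)$, $x+(y\wedge z)=(x+y)\wedge(x+z)$ and $x\cdot(y+z)\leq(x\cdot y)+z$. In it, $y$ is a complement of $x$ if $x\cdot y\leq 0$ and $1\leq x+y$ (unique if it exists, written $\overline{x}$). A commutative involutive residuated lattice $\langle B,\vee,\wedge,\cdot,1,\rightarrow,0\rangle$ is a lattice with a commutative monoid operation $\cdot$, an operation $\rightarrow$ with $x\cdot y\leq z\iff y\leq x\rightarrow z$, and a constant $0$ with $(x\rightarrow 0)\rightarrow 0=x$; setting $\overline{x}=x\rightarrow 0$ and $x+y:=\overline{\overline{x}\cdot\overline{y}}$, its $\ell$-bimonoid reduct is $\langle B,\vee,\wedge,\cdot,1,+,0\rangle$, and complete complemented commutative $\ell$-bimonoids are exactly (up to this term equivalence)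 complete commutative involutive residuated lattices. $\mathbf{A}$ is a subreduct of $\mathbf{B}$ if $\mathbf{A}$ embeds (as an $\ell$-bimonoid) into the $\ell$-bimonoid reduct of $\mathbf{B}$. The commutative complemented Dedekind--MacNeille completion $\mathbf{A}^{\Delta}$ is the (unique up to isomorphism over $\mathbf{A}$) complete complemented commutative $\ell$-bimonoid containing $\mathbf{A}$ as a sub-bimonoid in which elements $a\cdot\overline{b}$ ($a,b\in\mathbf{A}$) are join dense and elements $a+\overline{b}$ are meet dense. A positive universal clause is a universally quantified finite disjunction of equations. *)

theory Defs
  imports "HOL-Algebra.Group" "HOL-Algebra.Complete_Lattice"
begin

text \<open>
  The lattice operations of all algebras below are those that \<open>HOL-Algebra\<close> derives from the
  order of the underlying \<open>gorder\<close> record. The record \<open>mult_lattice\<close> is the common signature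
  of \<open>\<ell>\<close>-bimonoids and residuated lattices; it interprets terms over \<open>{\<or>, \<cdot>, 1}\<close>.
\<close>

record 'a mult_lattice = "'a gorder" +
  times :: "'a \<Rightarrow> 'a \<Rightarrow> 'a"  (infixl \<open>\<odot>\<index>\<close> 72)
  unit :: 'a  (\<open>\<e>\<index>\<close>)

record 'a lbimonoid = "'a mult_lattice" +
  plus :: "'a \<Rightarrow> 'a \<Rightarrow> 'a"  (infixl \<open>\<oplus>\<index>\<close> 68)
  zero :: 'a  (\<open>\<o>\<index>\<close>)

record 'a res_lattice = "'a mult_lattice" +
  residual :: "'a \<Rightarrow> 'a \<Rightarrow> 'a"  (infixr \<open>\<rightharpoonup>\<index>\<close> 67)
  falsum :: 'a  (\<open>\<ff>\<index>\<close>)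

locale comm_lbimonoid = lattice A
  for A :: "('a, 'm) lbimonoid_scheme" (structure) +
  assumes times_comm_monoid: "comm_monoid \<lparr>carrier = carrier A, mult = (\<odot>), one = \<e>\<rparr>"
    and plus_comm_monoid: "comm_monoid \<lparr>carrier = carrier A, mult = (\<oplus>), one = \<o>\<rparr>"
    and times_join: "\<lbrakk>x \<in> carrier A; y \<in> carrier A; z \<in> carrier A\<rbrakk>
      \<Longrightarrow> x \<odot> (y \<squnion> z) = (x \<odot> y) \<squnion> (x \<odot> z)"
    and plus_meet: "\<lbrakk>x \<in> carrier A; y \<in> carrier A; z \<in> carrier A\<rbrakk>
      \<Longrightarrow> x \<oplus> (y \<sqinter> z) = (x \<oplus> y) \<sqinter> (x \<oplus> z)"
    and hemidistrib: "\<lbrakk>x \<in> carrier A; y \<in> carrier A; z \<in> carrier A\<rbrakk>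
      \<Longrightarrow> x \<odot> (y \<oplus> z) \<sqsubseteq> (x \<odot> y) \<oplus> z"

definition is_complement :: "('a, 'm) lbimonoid_scheme \<Rightarrow> 'a \<Rightarrow> 'a \<Rightarrow> bool" where
  "is_complement A x y \<longleftrightarrow>
     x \<in> carrier A \<and> y \<in> carrier A \<and>
     x \<odot>\<^bsub>A\<^esub> y \<sqsubseteq>\<^bsub>A\<^esub> \<o>\<^bsub>A\<^esub> \<and> \<e>\<^bsub>A\<^esub> \<sqsubseteq>\<^bsub>A\<^esub> x \<oplus>\<^bsub>A\<^esub> y"

definition compl :: "('a, 'm) lbimonoid_scheme \<Rightarrow> 'a \<Rightarrow> 'a" where
  "compl A x = (THE y. is_complement A x y)"

locale complete_complemented_comm_lbimonoid = comm_lbimonoid D + complete_lattice D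
  for D :: "('d, 'm) lbimonoid_scheme" (structure) +
  assumes complemented: "x \<in> carrier D \<Longrightarrow> \<exists>y. is_complement D x y"

locale comm_inv_res_lattice = lattice B
  for B :: "('b, 'm) res_lattice_scheme" (structure) +
  assumes times_comm_monoid: "comm_monoid \<lparr>carrier = carrier B, mult = (\<odot>), one = \<e>\<rparr>"
    and residual_closed: "\<lbrakk>x \<in> carrier B; y \<in> carrier B\<rbrakk> \<Longrightarrow> x \<rightharpoonup> y \<in> carrier B"
    and falsum_closed: "\<ff> \<in> carrier B"
    and residuation: "\<lbrakk>x \<in> carrier B; y \<in> carrier B; z \<in> carrier B\<rbrakk>
      \<Longrightarrow> x \<odot> y \<sqsubseteq> z \<longleftrightarrow> y \<sqsubseteq> x \<rightharpoonup> z"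
    and involutive: "x \<in> carrier B \<Longrightarrow> (x \<rightharpoonup> \<ff>) \<rightharpoonup> \<ff> = x"

definition lbimonoid_reduct :: "('b, 'm) res_lattice_scheme \<Rightarrow> 'b lbimonoid" where
  "lbimonoid_reduct B =
     \<lparr>carrier = carrier B, eq = eq B, le = le B,
      times = times B, unit = unit B,
      plus = (\<lambda>x y. ((x \<rightharpoonup>\<^bsub>B\<^esub> \<ff>\<^bsub>B\<^esub>) \<odot>\<^bsub>B\<^esub> (y \<rightharpoonup>\<^bsub>B\<^esub> \<ff>\<^bsub>B\<^esub>)) \<rightharpoonup>\<^bsub>B\<^esub> \<ff>\<^bsub>B\<^esub>),
      zero = falsum B\<rparr>"

text \<open>
  The converse of \<open>lbimonoid_reduct\<close> for complemented \<open>\<ell>\<close>-bimonoids: the residual of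
  \<open>x\<close> and \<open>y\<close> is the sum of the complement of \<open>x\<close> and \<open>y\<close>.
\<close>

definition res_lattice_of :: "('d, 'm) lbimonoid_scheme \<Rightarrow> 'd res_lattice" where
  "res_lattice_of D =
     \<lparr>carrier = carrier D, eq = eq D, le = le D,
      times = times D, unit = unit D,
      residual = (\<lambda>x y. compl D x \<oplus>\<^bsub>D\<^esub> y),
      falsum = zero D\<rparr>"

definition lbimonoid_embedding ::
  "('a, 'm) lbimonoid_scheme \<Rightarrow> ('b, 'n) lbimonoid_scheme \<Rightarrow> ('a \<Rightarrow> 'b) \<Rightarrow> bool" where
  "lbimonoid_embedding A B h \<longleftrightarrow>
     h \<in> carrier A \<rightarrow> carrier B \<and> inj_on h (carrier A) \<and>
     (\<forall>x\<in>carrier A. \<forall>y\<in>carrier A.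
        h (x \<squnion>\<^bsub>A\<^esub> y) = h x \<squnion>\<^bsub>B\<^esub> h y \<and>
        h (x \<sqinter>\<^bsub>A\<^esub> y) = h x \<sqinter>\<^bsub>B\<^esub> h y \<and>
        h (x \<odot>\<^bsub>A\<^esub> y) = h x \<odot>\<^bsub>B\<^esub> h y \<and>
        h (x \<oplus>\<^bsub>A\<^esub> y) = h x \<oplus>\<^bsub>B\<^esub> h y) \<and>
     h \<e>\<^bsub>A\<^esub> = \<e>\<^bsub>B\<^esub> \<and> h \<o>\<^bsub>A\<^esub> = \<o>\<^bsub>B\<^esub>"

definition subreduct :: "('a, 'm) lbimonoid_scheme \<Rightarrow> ('b, 'n) res_lattice_scheme \<Rightarrow> bool" where
  "subreduct A B \<longleftrightarrow> (\<exists>h. lbimonoid_embedding A (lbimonoid_reduct B) h)"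

text \<open>
  A bimonoid is an ordered structure without lattice operations, so a sub-bimonoid is given by
  an order embedding that preserves the two monoid structures.
\<close>

definition bimonoid_embedding ::
  "('a, 'm) lbimonoid_scheme \<Rightarrow> ('b, 'n) lbimonoid_scheme \<Rightarrow> ('a \<Rightarrow> 'b) \<Rightarrow> bool" where
  "bimonoid_embedding A B h \<longleftrightarrow>
     h \<in> carrier A \<rightarrow> carrier B \<and> order_emb A B h \<and>
     (\<forall>x\<in>carrier A. \<forall>y\<in>carrier A.
        h (x \<odot>\<^bsub>A\<^esub> y) = h x \<odot>\<^bsub>B\<^esub> h y \<and>
        h (x \<oplus>\<^bsub>A\<^esub> y) = h x \<oplus>\<^bsub>B\<^esub> h y) \<and>
     h \<e>\<^bsub>A\<^esub> = \<e>\<^bsub>B\<^esub> \<and> h \<o>\<^bsub>A\<^esub> = \<o>\<^bsub>B\<^esub>"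

definition join_dense :: "('a, 'm) gorder_scheme \<Rightarrow> 'a set \<Rightarrow> bool" where
  "join_dense L P \<longleftrightarrow> P \<subseteq> carrier L \<and> (\<forall>x\<in>carrier L. \<exists>S\<subseteq>P. is_lub L x S)"

definition meet_dense :: "('a, 'm) gorder_scheme \<Rightarrow> 'a set \<Rightarrow> bool" where
  "meet_dense L P \<longleftrightarrow> P \<subseteq> carrier L \<and> (\<forall>x\<in>carrier L. \<exists>S\<subseteq>P. is_glb L x S)"

definition complemented_DM_completion ::
  "('a, 'm) lbimonoid_scheme \<Rightarrow> ('d, 'n) lbimonoid_scheme \<Rightarrow> ('a \<Rightarrow> 'd) \<Rightarrow> bool" where
  "complemented_DM_completion A D e \<longleftrightarrow>
     complete_complemented_comm_lbimonoid D \<and>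
     bimonoid_embedding A D e \<and>
     join_dense D {e a \<odot>\<^bsub>D\<^esub> compl D (e b) | a b. a \<in> carrier A \<and> b \<in> carrier A} \<and>
     meet_dense D {e a \<oplus>\<^bsub>D\<^esub> compl D (e b) | a b. a \<in> carrier A \<and> b \<in> carrier A}"

datatype tm = Var nat | One | Join tm tm | Times tm tm

primrec eval :: "('a, 'm) mult_lattice_scheme \<Rightarrow> (nat \<Rightarrow> 'a) \<Rightarrow> tm \<Rightarrow> 'a" where
  "eval L v (Var i) = v i"
| "eval L v One = \<e>\<^bsub>L\<^esub>"
| "eval L v (Join s t) = eval L v s \<squnion>\<^bsub>L\<^esub> eval L v t"
| "eval L v (Times s t) = eval L v s \<odot>\<^bsub>L\<^esub> eval L v t"

text \<open>A positive universal clause is the universal closure of the disjunction of a list of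
  equations.\<close>

type_synonym clause = "(tm \<times> tm) list"

definition satisfies :: "('a, 'm) mult_lattice_scheme \<Rightarrow> clause \<Rightarrow> bool" where
  "satisfies L \<pi> \<longleftrightarrow>
     (\<forall>v. range v \<subseteq> carrier L \<longrightarrow> (\<exists>(s, t)\<in>set \<pi>. eval L v s = eval L v t))"

definition models :: "('a, 'm) mult_lattice_scheme \<Rightarrow> clause set \<Rightarrow> bool" where
  "models L \<Gamma> \<longleftrightarrow> (\<forall>\<pi>\<in>\<Gamma>. satisfies L \<pi>)"

text \<open>
  The type argument is the universe that contains the carrier of the residuated lattice.
\<close>

definition subreduct_of_model ::
  "'b itself \<Rightarrow> ('a, 'm) lbimonoid_scheme \<Rightarrow> clause set \<Rightarrow> bool" where
  "subreduct_of_model _ A \<Gamma> \<longleftrightarrow>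
     (\<exists>B :: 'b res_lattice. comm_inv_res_lattice B \<and> models B \<Gamma> \<and> subreduct A B)"

end

theory Submission
  imports Defs
begin

text \<open>
  By residuation, \<open>a \<cdot> \<not> b \<le> c + \<not> d\<close> holds in an involutive residuated lattice containing
  \<open>A\<close> if and only if \<open>a \<cdot> d \<le> c + b\<close> holds in \<open>A\<close>. Suppose a clause over \<open>{\<or>, \<cdot>, 1}\<close> fails in
  the completion. Each variable is then a join of elements \<open>a \<cdot> \<not> b\<close>, and \<open>\<or>\<close> and \<open>\<cdot>\<close>
  distribute over these joins, so each of the finitely many failing inequations \<open>s \<le> t\<close> is
  witnessed by one product of such elements that is not below some \<open>c + \<not> d \<ge> t\<close>. Only
  finitely many \<open>a \<cdot> \<not> b\<close> occur in these products, and the clause fails in every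
  residuated lattice \<open>B\<close> containing \<open>A\<close> as soon as each variable is interpreted there as the
  join of the elements that were kept for it. If nothing was kept for a variable, a sufficiently
  small element of \<open>B\<close> takes the place of the bottom element that \<open>B\<close> may lack.
  Conversely, \<open>A\<close> is a subreduct of its completion: the density conditions and the
  distributivity of \<open>\<cdot>\<close> over \<open>\<or>\<close> and of \<open>+\<close> over \<open>\<and>\<close> in \<open>A\<close> make the order
  embedding preserve joins and meets.
\<close>

section \<open>Complemented commutative bimonoids as residuated lattices\<close>

text \<open>Stated for a bare carrier, operation and unit, so that the same laws serve
  \<open>times\<close> and \<open>plus\<close> in bimonoids and \<open>times\<close> in residuated
  lattices.\<close>

lemma comm_monoid_laws:
  assumes "comm_monoid \<lparr>carrier = C, mult = f, one = u\<rparr>"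
  shows "\<lbrakk>x \<in> C; y \<in> C\<rbrakk> \<Longrightarrow> f x y \<in> C"
    and "u \<in> C"
    and "\<lbrakk>x \<in> C; y \<in> C\<rbrakk> \<Longrightarrow> f x y = f y x"
    and "\<lbrakk>x \<in> C; y \<in> C; z \<in> C\<rbrakk> \<Longrightarrow> f (f x y) z = f x (f y z)"
    and "\<lbrakk>x \<in> C; y \<in> C; z \<in> C\<rbrakk> \<Longrightarrow> f x (f y z) = f y (f x z)"
    and "x \<in> C \<Longrightarrow> f x u = x"
    and "x \<in> C \<Longrightarrow> f u x = x"
proof -
  interpret M: comm_monoid "\<lparr>carrier = C, mult = f, one = u\<rparr>" by fact
  show "\<lbrakk>x \<in> C; y \<in> C\<rbrakk> \<Longrightarrow> f x y \<in> C" using M.m_closed by simp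
  show "u \<in> C" using M.one_closed by simp
  show "\<lbrakk>x \<in> C; y \<in> C\<rbrakk> \<Longrightarrow> f x y = f y x" using M.m_comm by simp
  show "\<lbrakk>x \<in> C; y \<in> C; z \<in> C\<rbrakk> \<Longrightarrow> f (f x y) z = f x (f y z)" using M.m_assoc by simp
  show "\<lbrakk>x \<in> C; y \<in> C; z \<in> C\<rbrakk> \<Longrightarrow> f x (f y z) = f y (f x z)" using M.m_lcomm by simp
  show "x \<in> C \<Longrightarrow> f x u = x" using M.r_one by simp
  show "x \<in> C \<Longrightarrow> f u x = x" using M.l_one by simp
qed

section \<open>Residuation and De Morgan laws for complements\<close>

context comm_lbimonoid
begin

lemmas times_closed = comm_monoid_laws(1)[OF times_comm_monoid]
  and unit_closed = comm_monoid_laws(2)[OF times_comm_monoid]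
  and times_comm = comm_monoid_laws(3)[OF times_comm_monoid]
  and times_assoc = comm_monoid_laws(4)[OF times_comm_monoid]
  and times_unit = comm_monoid_laws(6)[OF times_comm_monoid]
  and plus_closed = comm_monoid_laws(1)[OF plus_comm_monoid]
  and zero_closed = comm_monoid_laws(2)[OF plus_comm_monoid]
  and plus_comm = comm_monoid_laws(3)[OF plus_comm_monoid]
  and plus_assoc = comm_monoid_laws(4)[OF plus_comm_monoid]
  and plus_lcomm = comm_monoid_laws(5)[OF plus_comm_monoid]
  and plus_zero = comm_monoid_laws(6)[OF plus_comm_monoid]

lemmas closed = times_closed unit_closed plus_closed zero_closed

lemma times_mono:
  assumes "x \<in> carrier A" "y \<in> carrier A" "z \<in> carrier A" "y \<sqsubseteq> z"
  shows "x \<odot> y \<sqsubseteq> x \<odot> z"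
proof -
  have "(x \<odot> y) \<squnion> (x \<odot> z) = x \<odot> z"
    using assms times_join[of x y z] le_iff_meet[of y z] by simp
  then show ?thesis using assms by (simp add: le_iff_meet times_closed)
qed

lemma plus_mono:
  assumes "x \<in> carrier A" "y \<in> carrier A" "z \<in> carrier A" "y \<sqsubseteq> z"
  shows "x \<oplus> y \<sqsubseteq> x \<oplus> z"
proof -
  have "(x \<oplus> y) \<sqinter> (x \<oplus> z) = x \<oplus> y"
    using assms plus_meet[of x y z] le_iff_join[of y z] by simp
  then show ?thesis using assms by (simp add: le_iff_join plus_closed)
qed

lemma is_complement_sym: "is_complement A x y \<Longrightarrow> is_complement A y x"
  unfolding is_complement_def by (simp add: times_comm plus_comm)

text \<open>Each direction uses hemidistributivity once. Forwards, it is applied to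
  \<open>y \<odot> (x \<oplus> x')\<close>, which lies above \<open>y\<close>; backwards, to
  \<open>x \<odot> (x' \<oplus> z)\<close>, where \<open>x \<odot> x'\<close> is then absorbed by
  the zero.\<close>

lemma is_complement_residuation:
  assumes c: "is_complement A x x'" and y: "y \<in> carrier A" and z: "z \<in> carrier A"
  shows "x \<odot> y \<sqsubseteq> z \<longleftrightarrow> y \<sqsubseteq> x' \<oplus> z"
proof -
  have x: "x \<in> carrier A" and x': "x' \<in> carrier A"
    and c0: "x \<odot> x' \<sqsubseteq> \<o>" and c1: "\<e> \<sqsubseteq> x \<oplus> x'"
    using c by (auto simp: is_complement_def)
  note cl = closed x x' y z
  show ?thesis
  proof
    assume a: "x \<odot> y \<sqsubseteq> z"
    have "y \<odot> \<e> \<sqsubseteq> y \<odot> (x \<oplus> x')" using cl c1 by (intro times_mono) auto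
    also have "y \<odot> (x \<oplus> x') \<sqsubseteq> (y \<odot> x) \<oplus> x'" using cl by (intro hemidistrib) auto
    also have "(y \<odot> x) \<oplus> x' = x' \<oplus> (x \<odot> y)" using cl by (simp add: times_comm plus_comm)
    also have "x' \<oplus> (x \<odot> y) \<sqsubseteq> x' \<oplus> z" using cl a by (intro plus_mono) auto
    finally show "y \<sqsubseteq> x' \<oplus> z" using cl by (simp add: times_unit)
  next
    assume a: "y \<sqsubseteq> x' \<oplus> z"
    have "x \<odot> y \<sqsubseteq> x \<odot> (x' \<oplus> z)" using cl a by (intro times_mono) auto
    also have "x \<odot> (x' \<oplus> z) \<sqsubseteq> (x \<odot> x') \<oplus> z" using cl by (intro hemidistrib) auto
    also have "(x \<odot> x') \<oplus> z = z \<oplus> (x \<odot> x')" using cl by (simp add: plus_comm)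
    also have "z \<oplus> (x \<odot> x') \<sqsubseteq> z \<oplus> \<o>" using cl c0 by (intro plus_mono) auto
    finally show "x \<odot> y \<sqsubseteq> z" using cl by (simp add: plus_zero)
  qed
qed

lemma is_complement_unique:
  assumes "is_complement A x y" "is_complement A x z"
  shows "y = z"
proof -
  have *: "y \<in> carrier A" "z \<in> carrier A" "x \<odot> y \<sqsubseteq> \<o>" "x \<odot> z \<sqsubseteq> \<o>"
    using assms by (auto simp: is_complement_def)
  have "y \<sqsubseteq> z" "z \<sqsubseteq> y"
    using is_complement_residuation[OF assms(2), of y \<o>]
      is_complement_residuation[OF assms(1), of z \<o>] * closed by (auto simp: plus_zero)
  then show ?thesis using * by (intro le_antisym)
qed

lemma compl_eqI: "is_complement A x y \<Longrightarrow> compl A x = y"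
  unfolding compl_def using is_complement_unique by blast

text \<open>De Morgan law. Two residuations bound the product by the zero; for the unit,
  \<open>x'\<close> is enlarged in \<open>x \<oplus> x'\<close> to
  \<open>y \<oplus> (x' \<odot> y')\<close>.\<close>

lemma is_complement_times:
  assumes "is_complement A x x'" "is_complement A y y'"
  shows "is_complement A (x' \<odot> y') (x \<oplus> y)"
proof -
  have c: "x \<in> carrier A" "x' \<in> carrier A" "y \<in> carrier A" "y' \<in> carrier A"
    using assms by (auto simp: is_complement_def)
  note cl = closed c
  note res = is_complement_residuation[OF is_complement_sym[OF assms(1)]]
    is_complement_residuation[OF is_complement_sym[OF assms(2)]]
    is_complement_residuation[OF assms(1)] is_complement_residuation[OF assms(2)]
  have "y' \<odot> (x \<oplus> y) \<sqsubseteq> x"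
    using cl by (subst res) (simp_all add: plus_comm)
  then have "x' \<odot> (y' \<odot> (x \<oplus> y)) \<sqsubseteq> \<o>"
    using cl by (subst res) (simp_all add: plus_zero)
  then have 1: "(x' \<odot> y') \<odot> (x \<oplus> y) \<sqsubseteq> \<o>" using cl by (simp add: times_assoc)
  have "x' \<sqsubseteq> y \<oplus> (x' \<odot> y')"
    using cl res(2)[of x' "x' \<odot> y'"] by (simp add: times_comm)
  then have "x \<oplus> x' \<sqsubseteq> x \<oplus> (y \<oplus> (x' \<odot> y'))" using cl by (intro plus_mono) auto
  moreover have "\<e> \<sqsubseteq> x \<oplus> x'" using assms by (auto simp: is_complement_def)
  ultimately have "\<e> \<sqsubseteq> x \<oplus> (y \<oplus> (x' \<odot> y'))" using cl by (meson le_trans)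
  then have 2: "\<e> \<sqsubseteq> (x' \<odot> y') \<oplus> (x \<oplus> y)"
    using cl by (simp add: plus_assoc plus_comm plus_lcomm)
  show ?thesis using 1 2 cl by (simp add: is_complement_def)
qed

end

section \<open>Transport of the order structure between record types\<close>

lemma join_lbimonoid_reduct [simp]: "join (lbimonoid_reduct B) = join B"
  by (intro ext) (simp add: join_def sup_def least_def Upper_def lbimonoid_reduct_def)

lemma meet_lbimonoid_reduct [simp]: "meet (lbimonoid_reduct B) = meet B"
  by (intro ext) (simp add: meet_def inf_def greatest_def Lower_def lbimonoid_reduct_def)

text \<open>Bounds and least and greatest elements depend on these three fields only, so being a
  lattice survives a change of the algebraic signature.\<close>

lemma lattice_cong:
  assumes "lattice L" "carrier M = carrier L" "eq M = eq L" "le M = le L"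
  shows "lattice M"
proof -
  interpret lattice L by fact
  have "Upper M S = Upper L S" "Lower M S = Lower L S" for S
    using assms by (auto simp: Upper_def Lower_def)
  moreover have "least M x S = least L x S" "greatest M x S = greatest L x S" for x S
    using assms by (auto simp: least_def greatest_def)
  moreover have "partial_order M"
  proof
    show "x .=\<^bsub>M\<^esub> z" if "x .=\<^bsub>M\<^esub> y" "y .=\<^bsub>M\<^esub> z" for x y z
      using that by (simp add: assms eq_is_equal)
    show "x \<sqsubseteq>\<^bsub>M\<^esub> z" if "x \<sqsubseteq>\<^bsub>M\<^esub> y" "y \<sqsubseteq>\<^bsub>M\<^esub> z" "x \<in> carrier M" "y \<in> carrier M" "z \<in> carrier M" for x y z
      using that le_trans by (simp add: assms)
  qed (simp_all add: assms eq_is_equal le_antisym)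
  ultimately show ?thesis
    by (intro lattice.intro upper_semilattice.intro lower_semilattice.intro
        upper_semilattice_axioms.intro lower_semilattice_axioms.intro)
      (simp_all add: assms(2) sup_of_two_exists inf_of_two_exists)
qed

context complete_complemented_comm_lbimonoid
begin

lemma is_complement_compl: "x \<in> carrier D \<Longrightarrow> is_complement D x (compl D x)"
  using complemented compl_eqI by metis

lemma compl_closed: "x \<in> carrier D \<Longrightarrow> compl D x \<in> carrier D"
  using is_complement_compl by (auto simp: is_complement_def)

lemma compl_compl: "x \<in> carrier D \<Longrightarrow> compl D (compl D x) = x"
  by (simp add: compl_eqI is_complement_sym is_complement_compl)

lemma compl_times_compl:
  "\<lbrakk>x \<in> carrier D; y \<in> carrier D\<rbrakk> \<Longrightarrow> compl D (compl D x \<odot> compl D y) = x \<oplus> y"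
  by (intro compl_eqI is_complement_times is_complement_compl)

text \<open>Residuation is the residuation law for complements. Since the residual of
  \<open>x\<close> and the zero is \<open>compl D x\<close>, involutivity is the double complement
  law.\<close>

lemma comm_inv_res_lattice_res_lattice_of: "comm_inv_res_lattice (res_lattice_of D)"
proof -
  have lat: "lattice (res_lattice_of D)"
    by (rule lattice_cong[of D]) (simp_all add: res_lattice_of_def lattice_axioms)
  show ?thesis
  proof (intro comm_inv_res_lattice.intro lat comm_inv_res_lattice_axioms.intro)
    show "comm_monoid \<lparr>carrier = carrier (res_lattice_of D), mult = times (res_lattice_of D),
        one = unit (res_lattice_of D)\<rparr>"
      using times_comm_monoid by (simp add: res_lattice_of_def)
  qed (simp_all add: res_lattice_of_def closed compl_closed compl_compl plus_zero
      is_complement_residuation[OF is_complement_compl])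
qed

lemma residual_zero_res_lattice_of:
  "x \<in> carrier D \<Longrightarrow> x \<rightharpoonup>\<^bsub>res_lattice_of D\<^esub> \<ff>\<^bsub>res_lattice_of D\<^esub> = compl D x"
  by (simp add: res_lattice_of_def compl_closed plus_zero)

text \<open>By De Morgan, the sum rebuilt from product and negation is the original one, so the two
  translations between signatures are compatible.\<close>

lemma plus_reduct_res_lattice_of:
  "\<lbrakk>x \<in> carrier D; y \<in> carrier D\<rbrakk> \<Longrightarrow> x \<oplus>\<^bsub>lbimonoid_reduct (res_lattice_of D)\<^esub> y = x \<oplus> y"
  by (simp add: lbimonoid_reduct_def res_lattice_of_def compl_closed plus_zero closed
      compl_times_compl)

end

section \<open>Embeddings into involutive residuated lattices\<close>

context comm_inv_res_lattice
begin

lemmas times_closed = comm_monoid_laws(1)[OF times_comm_monoid]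
  and unit_closed = comm_monoid_laws(2)[OF times_comm_monoid]
  and times_comm = comm_monoid_laws(3)[OF times_comm_monoid]
  and times_assoc = comm_monoid_laws(4)[OF times_comm_monoid]
  and times_lcomm = comm_monoid_laws(5)[OF times_comm_monoid]
  and times_unit = comm_monoid_laws(6)[OF times_comm_monoid]
  and unit_times = comm_monoid_laws(7)[OF times_comm_monoid]

lemmas times_ac = times_assoc times_comm times_lcomm
lemmas closed = times_closed unit_closed residual_closed falsum_closed

lemma residuation_flip:
  "\<lbrakk>x \<in> carrier B; y \<in> carrier B; z \<in> carrier B\<rbrakk> \<Longrightarrow> x \<odot> y \<sqsubseteq> z \<longleftrightarrow> x \<sqsubseteq> y \<rightharpoonup> z"
  using residuation[of y x z] by (simp add: times_comm)

text \<open>Both sides say \<open>x \<odot> y \<sqsubseteq> z\<close>. The swap lets a bound on one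
  factor of a product be turned into a bound on the other.\<close>

lemma residual_swap:
  "\<lbrakk>x \<in> carrier B; y \<in> carrier B; z \<in> carrier B\<rbrakk> \<Longrightarrow> x \<sqsubseteq> y \<rightharpoonup> z \<longleftrightarrow> y \<sqsubseteq> x \<rightharpoonup> z"
  using residuation residuation_flip by blast

lemma times_mono:
  assumes "x \<in> carrier B" "y \<in> carrier B" "x' \<in> carrier B" "y' \<in> carrier B"
    and "x \<sqsubseteq> x'" "y \<sqsubseteq> y'"
  shows "x \<odot> y \<sqsubseteq> x' \<odot> y'"
proof -
  have "y' \<sqsubseteq> x' \<rightharpoonup> (x' \<odot> y')" "x' \<sqsubseteq> y \<rightharpoonup> (x' \<odot> y)"
    using assms closed residuation[of x' y' "x' \<odot> y'"] residuation_flip[of x' y "x' \<odot> y"]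
    by simp_all
  then have "y \<sqsubseteq> x' \<rightharpoonup> (x' \<odot> y')" "x \<sqsubseteq> y \<rightharpoonup> (x' \<odot> y)"
    using assms closed le_trans by meson+
  then have "x' \<odot> y \<sqsubseteq> x' \<odot> y'" "x \<odot> y \<sqsubseteq> x' \<odot> y"
    using assms closed residuation[of x' y "x' \<odot> y'"] residuation_flip[of x y "x' \<odot> y"]
    by simp_all
  then show ?thesis using assms closed le_trans by meson
qed

lemma residual_falsum_unit: "\<e> \<rightharpoonup> \<ff> = \<ff>"
proof (rule le_antisym)
  show "\<e> \<rightharpoonup> \<ff> \<sqsubseteq> \<ff>"
    using residuation[of \<e> "\<e> \<rightharpoonup> \<ff>" \<ff>] closed by (simp add: unit_times)
  show "\<ff> \<sqsubseteq> \<e> \<rightharpoonup> \<ff>"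
    using residuation[of \<e> \<ff> \<ff>] closed by (simp add: unit_times)
qed (simp_all add: closed)

lemma residual_falsum_falsum: "\<ff> \<rightharpoonup> \<ff> = \<e>"
  using involutive[OF unit_closed] residual_falsum_unit by simp

lemma eval_closed: "range v \<subseteq> carrier B \<Longrightarrow> eval B v t \<in> carrier B"
  by (induction t) (auto simp: closed)

end

text \<open>The generators \<open>a \<cdot> \<not> b\<close> and \<open>c + \<not> d\<close>; the latter is spelled out as
  \<open>\<not> (\<not> c \<cdot> \<not> \<not> d)\<close>.\<close>

definition join_generator :: "('b, 'n) res_lattice_scheme \<Rightarrow> ('a \<Rightarrow> 'b) \<Rightarrow> 'a \<times> 'a \<Rightarrow> 'b" where
  "join_generator B h p = h (fst p) \<odot>\<^bsub>B\<^esub> (h (snd p) \<rightharpoonup>\<^bsub>B\<^esub> \<ff>\<^bsub>B\<^esub>)"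

definition meet_generator :: "('b, 'n) res_lattice_scheme \<Rightarrow> ('a \<Rightarrow> 'b) \<Rightarrow> 'a \<times> 'a \<Rightarrow> 'b" where
  "meet_generator B h p =
     h (fst p) \<oplus>\<^bsub>lbimonoid_reduct B\<^esub> (h (snd p) \<rightharpoonup>\<^bsub>B\<^esub> \<ff>\<^bsub>B\<^esub>)"

text \<open>The formal expansion of a term as a join of products of generators, when the variable
  \<open>i\<close> stands for the join of the generators coded by \<open>L i\<close>.\<close>

primrec monomials ::
  "('a, 'm) lbimonoid_scheme \<Rightarrow> (nat \<Rightarrow> ('a \<times> 'a) set) \<Rightarrow> tm \<Rightarrow> ('a \<times> 'a) set" where
  "monomials A L (Var i) = L i"
| "monomials A L One = {(\<e>\<^bsub>A\<^esub>, \<o>\<^bsub>A\<^esub>)}"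
| "monomials A L (Join s t) = monomials A L s \<union> monomials A L t"
| "monomials A L (Times s t) =
     (\<lambda>(p, q). (fst p \<odot>\<^bsub>A\<^esub> fst q, snd p \<oplus>\<^bsub>A\<^esub> snd q)) ` (monomials A L s \<times> monomials A L t)"

section \<open>Finiteness of the formal expansion\<close>

lemma monomials_mono: "(\<And>i. L i \<subseteq> M i) \<Longrightarrow> monomials A L t \<subseteq> monomials A M t"
  by (induction t) fastforce+

text \<open>A monomial picks at most one generator for each occurrence of a variable. For a product,
  the finite choices made for the two factors are united.\<close>

lemma monomials_compact:
  "p \<in> monomials A L t \<Longrightarrow> \<exists>M. (\<forall>i. finite (M i) \<and> M i \<subseteq> L i) \<and> p \<in> monomials A M t"
proof (induction t arbitrary: p)
  case (Var i)
  then show ?case by (intro exI[of _ "\<lambda>j. if j = i then {p} else {}"]) auto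
next
  case One
  then show ?case by (intro exI[of _ "\<lambda>_. {}"]) auto
next
  case (Join s t)
  then show ?case by (metis Un_iff monomials.simps(3))
next
  case (Times s t)
  then obtain q r where qr: "q \<in> monomials A L s" "r \<in> monomials A L t"
    and p: "p = (fst q \<odot>\<^bsub>A\<^esub> fst r, snd q \<oplus>\<^bsub>A\<^esub> snd r)" by auto
  obtain M N where M: "\<forall>i. finite (M i) \<and> M i \<subseteq> L i" "q \<in> monomials A M s"
    and N: "\<forall>i. finite (N i) \<and> N i \<subseteq> L i" "r \<in> monomials A N t"
    using Times.IH qr by meson
  have "q \<in> monomials A (\<lambda>i. M i \<union> N i) s" "r \<in> monomials A (\<lambda>i. M i \<union> N i) t"
    using M N monomials_mono[of M "\<lambda>i. M i \<union> N i"] monomials_mono[of N "\<lambda>i. M i \<union> N i"]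
    by blast+
  then show ?case using M N p by (intro exI[of _ "\<lambda>i. M i \<union> N i"]) force
qed

text \<open>A common setting for the completion, whose definition gives a bimonoid embedding, and
  for subreducts, whose lattice embeddings are bimonoid embeddings.\<close>

locale bimonoid_embedding_in_res_lattice =
  A: comm_lbimonoid A + B: comm_inv_res_lattice B
  for A :: "('a, 'm) lbimonoid_scheme" and B :: "('b, 'n) res_lattice_scheme" (structure) +
  fixes h :: "'a \<Rightarrow> 'b"
  assumes emb: "bimonoid_embedding A (lbimonoid_reduct B) h"
begin

lemma h_closed: "a \<in> carrier A \<Longrightarrow> h a \<in> carrier B"
  using emb by (auto simp: bimonoid_embedding_def lbimonoid_reduct_def)

lemma h_le_iff: "\<lbrakk>a \<in> carrier A; b \<in> carrier A\<rbrakk> \<Longrightarrow> h a \<sqsubseteq> h b \<longleftrightarrow> a \<sqsubseteq>\<^bsub>A\<^esub> b"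
  using emb by (auto simp: bimonoid_embedding_def lbimonoid_reduct_def order_emb_def)

lemma h_times: "\<lbrakk>a \<in> carrier A; b \<in> carrier A\<rbrakk> \<Longrightarrow> h (a \<odot>\<^bsub>A\<^esub> b) = h a \<odot> h b"
  using emb by (auto simp: bimonoid_embedding_def lbimonoid_reduct_def)

lemma h_plus:
  "\<lbrakk>a \<in> carrier A; b \<in> carrier A\<rbrakk> \<Longrightarrow> h (a \<oplus>\<^bsub>A\<^esub> b) = ((h a \<rightharpoonup> \<ff>) \<odot> (h b \<rightharpoonup> \<ff>)) \<rightharpoonup> \<ff>"
  using emb by (auto simp: bimonoid_embedding_def lbimonoid_reduct_def)

lemma h_unit: "h \<e>\<^bsub>A\<^esub> = \<e>" and h_zero: "h \<o>\<^bsub>A\<^esub> = \<ff>"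
  using emb by (auto simp: bimonoid_embedding_def lbimonoid_reduct_def)

section \<open>Generators, their comparison and their products\<close>

abbreviation "pairs \<equiv> carrier A \<times> carrier A"

lemma join_generator_closed: "p \<in> pairs \<Longrightarrow> join_generator B h p \<in> carrier B"
  by (auto simp: join_generator_def h_closed B.closed)

lemma meet_generator_closed: "p \<in> pairs \<Longrightarrow> meet_generator B h p \<in> carrier B"
  by (auto simp: meet_generator_def lbimonoid_reduct_def h_closed B.closed)

text \<open>Comparing generators is a question about \<open>A\<close> alone; this is what lets inequations be
  moved between different residuated lattices containing \<open>A\<close>.\<close>

lemma generator_le_iff:
  assumes "a \<in> carrier A" "b \<in> carrier A" "c \<in> carrier A" "d \<in> carrier A"
  shows "join_generator B h (a, b) \<sqsubseteq> meet_generator B h (c, d)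
    \<longleftrightarrow> a \<odot>\<^bsub>A\<^esub> d \<sqsubseteq>\<^bsub>A\<^esub> c \<oplus>\<^bsub>A\<^esub> b"
proof -
  note cl = assms h_closed B.closed
  \<comment> \<open>As the meet generator is a negation, the inequality says that a product of four
    factors lies below \<open>\<ff>\<close>. Regrouping pairs \<open>h a\<close> with
    \<open>h d\<close>, and \<not> c with \<not> b, whose product has negation c + b.\<close>
  have "join_generator B h (a, b) \<sqsubseteq> meet_generator B h (c, d)
      \<longleftrightarrow> (h a \<odot> (h b \<rightharpoonup> \<ff>)) \<odot> ((h c \<rightharpoonup> \<ff>) \<odot> h d) \<sqsubseteq> \<ff>"
    unfolding join_generator_def meet_generator_def lbimonoid_reduct_def
    using cl by (simp add: B.residuation_flip B.involutive)
  also have "(h a \<odot> (h b \<rightharpoonup> \<ff>)) \<odot> ((h c \<rightharpoonup> \<ff>) \<odot> h d)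
      = (h a \<odot> h d) \<odot> ((h c \<rightharpoonup> \<ff>) \<odot> (h b \<rightharpoonup> \<ff>))"
    using cl by (simp add: B.times_ac)
  also have "\<dots> \<sqsubseteq> \<ff> \<longleftrightarrow> h (a \<odot>\<^bsub>A\<^esub> d) \<sqsubseteq> h (c \<oplus>\<^bsub>A\<^esub> b)"
    using cl by (simp add: B.residuation_flip h_times h_plus)
  finally show ?thesis using assms by (simp add: h_le_iff A.closed)
qed

lemma join_generator_unit: "join_generator B h (\<e>\<^bsub>A\<^esub>, \<o>\<^bsub>A\<^esub>) = \<e>"
  by (simp add: join_generator_def h_unit h_zero B.residual_falsum_falsum B.times_unit B.closed)

text \<open>(a \<cdot> \<not> b) \<cdot> (c \<cdot> \<not> d) = (a \<cdot> c) \<cdot> \<not> (b + d)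
  by De Morgan. Hence join generators are closed under products, which justifies the product clause
  of \<open>monomials\<close>.\<close>

lemma join_generator_times:
  assumes "p \<in> pairs" "q \<in> pairs"
  shows "join_generator B h (fst p \<odot>\<^bsub>A\<^esub> fst q, snd p \<oplus>\<^bsub>A\<^esub> snd q)
    = join_generator B h p \<odot> join_generator B h q"
  using assms
  by (auto simp: join_generator_def h_times h_plus h_closed B.closed B.involutive B.times_ac)

text \<open>Because \<not> 0 = 1, elements of \<open>A\<close> are themselves join generators;
  dually they are meet generators. So \<open>generator_le_iff\<close> also compares them with
  arbitrary generators.\<close>

lemma join_generator_zero: "a \<in> carrier A \<Longrightarrow> join_generator B h (a, \<o>\<^bsub>A\<^esub>) = h a"
  by (simp add: join_generator_def h_zero B.residual_falsum_falsum B.times_unit h_closed)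

lemma meet_generator_unit: "a \<in> carrier A \<Longrightarrow> meet_generator B h (a, \<e>\<^bsub>A\<^esub>) = h a"
  by (simp add: meet_generator_def lbimonoid_reduct_def h_unit B.residual_falsum_unit
      B.residual_falsum_falsum B.times_unit B.involutive h_closed B.closed)

section \<open>Evaluation of terms against their monomials\<close>

lemma monomials_closed: "(\<And>i. L i \<subseteq> pairs) \<Longrightarrow> monomials A L t \<subseteq> pairs"
  by (induction t) (fastforce simp: A.closed)+

text \<open>The easy half of the expansion: the term operations are monotone, so lower bounds for
  the variables suffice.\<close>

lemma monomial_le_eval:
  assumes L: "\<And>i. L i \<subseteq> pairs" and v: "range v \<subseteq> carrier B"
    and le: "\<And>i p. p \<in> L i \<Longrightarrow> join_generator B h p \<sqsubseteq> v i"
  shows "p \<in> monomials A L t \<Longrightarrow> join_generator B h p \<sqsubseteq> eval B v t"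
proof (induction t arbitrary: p)
  case (Var i)
  then show ?case using le by simp
next
  case One
  then show ?case by (simp add: join_generator_unit B.closed)
next
  case (Join s t)
  have cl: "eval B v s \<in> carrier B" "eval B v t \<in> carrier B" "join_generator B h p \<in> carrier B"
    using B.eval_closed[OF v] join_generator_closed monomials_closed[of L, OF L] Join.prems by blast+
  then show ?case
    using Join B.join_left[OF cl(1,2)] B.join_right[OF cl(1,2)]
    by (metis B.join_closed B.le_trans Un_iff eval.simps(3) monomials.simps(3))
next
  case (Times s t)
  then obtain q r where qr: "q \<in> monomials A L s" "r \<in> monomials A L t"
    and p: "p = (fst q \<odot>\<^bsub>A\<^esub> fst r, snd q \<oplus>\<^bsub>A\<^esub> snd r)" by auto
  have "q \<in> pairs" "r \<in> pairs" using qr monomials_closed[of L, OF L] by blast+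
  then show ?case
    unfolding p using Times.IH qr B.eval_closed[OF v]
    by (simp only: join_generator_times eval.simps)
      (intro B.times_mono join_generator_closed, auto)
qed

text \<open>If some \<open>L i\<close> is empty then the variable \<open>i\<close> ought to be a least element, which need not
  exist. It is replaced by an element \<open>q \<sqsubseteq> 1\<close> to be chosen small: a product involving such a
  variable is below \<open>q \<cdot> K\<close>, since \<open>q \<cdot> q \<sqsubseteq> q\<close>.\<close>

definition approx :: "(nat \<Rightarrow> ('a \<times> 'a) set) \<Rightarrow> 'b \<Rightarrow> nat \<Rightarrow> 'b" where
  "approx L q i = (if L i = {} then q else \<Squnion>(join_generator B h ` L i))"

lemma approx_closed:
  assumes "\<And>i. finite (L i)" "\<And>i. L i \<subseteq> pairs" "q \<in> carrier B"
  shows "range (approx L q) \<subseteq> carrier B"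
  using assms join_generator_closed by (auto simp: approx_def intro!: B.finite_sup_closed) blast

lemma join_generator_le_approx:
  assumes "finite (L i)" "L i \<subseteq> pairs" "p \<in> L i"
  shows "join_generator B h p \<sqsubseteq> approx L q i"
proof -
  have sub: "join_generator B h ` L i \<subseteq> carrier B" using assms(2) join_generator_closed by blast
  have "least B (\<Squnion>(join_generator B h ` L i)) (Upper B (join_generator B h ` L i))"
    using assms sub by (intro B.finite_sup_least) auto
  then show ?thesis
    using least_Upper_above[OF _ _ sub] assms by (auto simp: approx_def)
qed

lemma approx_le:
  assumes "finite (L i)" "L i \<subseteq> pairs" "w \<in> carrier B"
    and "\<And>p. p \<in> L i \<Longrightarrow> join_generator B h p \<sqsubseteq> w" and "q \<sqsubseteq> w"
  shows "approx L q i \<sqsubseteq> w"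
proof (cases "L i = {}")
  case True
  then show ?thesis using assms by (simp add: approx_def)
next
  case False
  have sub: "join_generator B h ` L i \<subseteq> carrier B" using assms(2) join_generator_closed by blast
  have "least B (\<Squnion>(join_generator B h ` L i)) (Upper B (join_generator B h ` L i))"
    using assms sub False by (intro B.finite_sup_least) auto
  moreover have "w \<in> Upper B (join_generator B h ` L i)"
    using assms by (auto simp: Upper_def)
  ultimately show ?thesis using False by (simp add: approx_def least_le)
qed

text \<open>\<open>K\<close> controls the error made by using \<open>q\<close> as a substitute for a
  bottom element: the parts of the value that involve \<open>q\<close> lie below
  \<open>q \<odot> K\<close>. It depends on neither \<open>q\<close> nor \<open>w\<close>, so
  \<open>q\<close> can be chosen afterwards; quantifying over \<open>w\<close> inside the induction
  allows residuals as bounds.\<close>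

lemma eval_approx_bound:
  assumes fin: "\<And>i. finite (L i)" and L: "\<And>i. L i \<subseteq> pairs"
  shows "\<exists>K\<in>carrier B. (\<forall>p\<in>monomials A L t. join_generator B h p \<sqsubseteq> K) \<and>
    (\<forall>q\<in>carrier B. \<forall>w\<in>carrier B. q \<sqsubseteq> \<e> \<longrightarrow> (\<forall>p\<in>monomials A L t. join_generator B h p \<sqsubseteq> w) \<longrightarrow>
      q \<odot> K \<sqsubseteq> w \<longrightarrow> eval B (approx L q) t \<sqsubseteq> w)"
proof (induction t)
  case (Var i)
  \<comment> \<open>With \<open>\<e>\<close> included, \<open>q\<close> lies below
    \<open>q \<odot> K\<close>, which covers the case of an empty \<open>L i\<close>.\<close>
  let ?S = "insert \<e> (join_generator B h ` L i)"
  have sub: "?S \<subseteq> carrier B" using L join_generator_closed B.closed by blast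
  have "least B (\<Squnion>?S) (Upper B ?S)" using fin sub by (intro B.finite_sup_least) auto
  then have K: "\<Squnion>?S \<in> carrier B" "\<And>x. x \<in> ?S \<Longrightarrow> x \<sqsubseteq> \<Squnion>?S"
    using least_Upper_above[OF _ _ sub] by auto
  have "approx L q i \<sqsubseteq> w"
    if "q \<in> carrier B" "w \<in> carrier B" "\<forall>p\<in>L i. join_generator B h p \<sqsubseteq> w" "q \<odot> \<Squnion>?S \<sqsubseteq> w" for q w
  proof -
    have "q \<odot> \<e> \<sqsubseteq> q \<odot> \<Squnion>?S" using that K B.closed by (intro B.times_mono) auto
    then have "q \<sqsubseteq> w" using that K B.closed B.times_unit B.le_trans by metis
    then show ?thesis using that fin L by (intro approx_le) auto
  qed
  then show ?case using K by (intro bexI[of _ "\<Squnion>?S"]) auto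
next
  case One
  then show ?case by (intro bexI[of _ \<e>]) (auto simp: join_generator_unit B.closed)
next
  case (Join s t)
  obtain K K' where K: "K \<in> carrier B" "\<forall>p\<in>monomials A L s. join_generator B h p \<sqsubseteq> K"
      "\<forall>q\<in>carrier B. \<forall>w\<in>carrier B. q \<sqsubseteq> \<e> \<longrightarrow> (\<forall>p\<in>monomials A L s. join_generator B h p \<sqsubseteq> w) \<longrightarrow>
        q \<odot> K \<sqsubseteq> w \<longrightarrow> eval B (approx L q) s \<sqsubseteq> w"
    and K': "K' \<in> carrier B" "\<forall>p\<in>monomials A L t. join_generator B h p \<sqsubseteq> K'"
      "\<forall>q\<in>carrier B. \<forall>w\<in>carrier B. q \<sqsubseteq> \<e> \<longrightarrow> (\<forall>p\<in>monomials A L t. join_generator B h p \<sqsubseteq> w) \<longrightarrow>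
        q \<odot> K' \<sqsubseteq> w \<longrightarrow> eval B (approx L q) t \<sqsubseteq> w"
    using Join.IH by blast
  have le: "K \<sqsubseteq> K \<squnion> K'" "K' \<sqsubseteq> K \<squnion> K'" and cl: "K \<squnion> K' \<in> carrier B"
    using K(1) K'(1) B.join_left B.join_right by auto
  show ?case
  proof (intro bexI[OF _ cl] conjI ballI impI)
    fix p assume "p \<in> monomials A L (Join s t)"
    moreover from this have "join_generator B h p \<in> carrier B"
      using monomials_closed[of L, OF L] join_generator_closed by blast
    ultimately show "join_generator B h p \<sqsubseteq> K \<squnion> K'"
      using K(1,2) K'(1,2) le cl B.le_trans by (metis Un_iff monomials.simps(3))
  next
    fix q w assume q: "q \<in> carrier B" "w \<in> carrier B" "q \<sqsubseteq> \<e>"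
      and p: "\<forall>p\<in>monomials A L (Join s t). join_generator B h p \<sqsubseteq> w"
      and qw: "q \<odot> (K \<squnion> K') \<sqsubseteq> w"
    have "q \<odot> K \<sqsubseteq> q \<odot> (K \<squnion> K')" "q \<odot> K' \<sqsubseteq> q \<odot> (K \<squnion> K')"
      using q K(1) K'(1) le cl by (auto intro: B.times_mono)
    then have "q \<odot> K \<sqsubseteq> w" "q \<odot> K' \<sqsubseteq> w"
      using qw q K(1) K'(1) cl B.closed B.le_trans by meson+
    then have "eval B (approx L q) s \<sqsubseteq> w" "eval B (approx L q) t \<sqsubseteq> w"
      using K(3) K'(3) q p by auto
    then show "eval B (approx L q) (Join s t) \<sqsubseteq> w"
      using q B.eval_closed[OF approx_closed[of L, OF fin L]] by (auto intro: B.join_le)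
  qed
next
  case (Times s t)
  obtain K K' where K: "K \<in> carrier B" "\<forall>p\<in>monomials A L s. join_generator B h p \<sqsubseteq> K"
      "\<forall>q\<in>carrier B. \<forall>w\<in>carrier B. q \<sqsubseteq> \<e> \<longrightarrow> (\<forall>p\<in>monomials A L s. join_generator B h p \<sqsubseteq> w) \<longrightarrow>
        q \<odot> K \<sqsubseteq> w \<longrightarrow> eval B (approx L q) s \<sqsubseteq> w"
    and K': "K' \<in> carrier B" "\<forall>p\<in>monomials A L t. join_generator B h p \<sqsubseteq> K'"
      "\<forall>q\<in>carrier B. \<forall>w\<in>carrier B. q \<sqsubseteq> \<e> \<longrightarrow> (\<forall>p\<in>monomials A L t. join_generator B h p \<sqsubseteq> w) \<longrightarrow>
        q \<odot> K' \<sqsubseteq> w \<longrightarrow> eval B (approx L q) t \<sqsubseteq> w"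
    using Times.IH by blast
  have cl: "K \<odot> K' \<in> carrier B" using K(1) K'(1) B.closed by simp
  have gs: "p \<in> pairs" "join_generator B h p \<in> carrier B" if "p \<in> monomials A L s" for p
    using that monomials_closed[of L, OF L] join_generator_closed by blast+
  have gt: "p \<in> pairs" "join_generator B h p \<in> carrier B" if "p \<in> monomials A L t" for p
    using that monomials_closed[of L, OF L] join_generator_closed by blast+
  show ?case
  proof (intro bexI[OF _ cl] conjI ballI impI)
    fix p assume "p \<in> monomials A L (Times s t)"
    then obtain a b where ab: "a \<in> monomials A L s" "b \<in> monomials A L t"
      and p: "p = (fst a \<odot>\<^bsub>A\<^esub> fst b, snd a \<oplus>\<^bsub>A\<^esub> snd b)" by auto
    show "join_generator B h p \<sqsubseteq> K \<odot> K'"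
      unfolding p join_generator_times[OF gs(1)[OF ab(1)] gt(1)[OF ab(2)]]
      using ab gs gt K(1,2) K'(1,2) by (intro B.times_mono) auto
  next
    fix q w assume q: "q \<in> carrier B" and w: "w \<in> carrier B" and qe: "q \<sqsubseteq> \<e>"
      and p: "\<forall>p\<in>monomials A L (Times s t). join_generator B h p \<sqsubseteq> w"
      and qw: "q \<odot> (K \<odot> K') \<sqsubseteq> w"
    let ?s = "eval B (approx L q) s" and ?t = "eval B (approx L q) t"
    have ec: "?s \<in> carrier B" "?t \<in> carrier B"
      using q B.eval_closed[OF approx_closed[of L, OF fin L]] by auto
    have ab: "join_generator B h a \<odot> join_generator B h b \<sqsubseteq> w"
      if "a \<in> monomials A L s" "b \<in> monomials A L t" for a b
    proof -
      have "(fst a \<odot>\<^bsub>A\<^esub> fst b, snd a \<oplus>\<^bsub>A\<^esub> snd b) \<in> monomials A L (Times s t)"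
        using that by force
      then show ?thesis using p join_generator_times that gs gt by metis
    qed
    have mix: "x \<odot> y \<sqsubseteq> w" if "x \<in> carrier B" "y \<in> carrier B" "x \<odot> y \<sqsubseteq> q \<odot> (K \<odot> K')" for x y
      using that qw q w cl B.closed B.le_trans by meson
    \<comment> \<open>With a monomial of \<open>s\<close> fixed, the induction hypothesis for
      \<open>t\<close> is used with a residual as bound.\<close>
    have t_le: "?t \<sqsubseteq> join_generator B h a \<rightharpoonup> w" if a: "a \<in> monomials A L s" for a
    proof -
      note ga = gs[OF a]
      have "join_generator B h a \<odot> (q \<odot> K') = q \<odot> (join_generator B h a \<odot> K')"
        using ga q K'(1) B.closed by (simp add: B.times_ac)
      also have "\<dots> \<sqsubseteq> q \<odot> (K \<odot> K')"
        using a ga q K K' B.closed by (intro B.times_mono) auto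
      finally have "join_generator B h a \<odot> (q \<odot> K') \<sqsubseteq> w"
        using mix ga q K'(1) B.closed by auto
      then have "q \<odot> K' \<sqsubseteq> join_generator B h a \<rightharpoonup> w"
        using ga q w K'(1) B.closed by (simp add: B.residuation)
      moreover have "join_generator B h b \<sqsubseteq> join_generator B h a \<rightharpoonup> w" if "b \<in> monomials A L t" for b
        using ab[OF a that] ga gt[OF that] w by (simp add: B.residuation)
      ultimately show ?thesis using K'(3) q qe w ga B.closed by auto
    qed
    \<comment> \<open>Now the factor from \<open>s\<close> is itself an error term. Two error terms
      multiply to something containing \<open>q\<close> twice, and
      \<open>q \<sqsubseteq> \<e>\<close> removes one of them.\<close>
    have t_le': "?t \<sqsubseteq> (q \<odot> K) \<rightharpoonup> w"
    proof -
      have "(q \<odot> K) \<odot> (q \<odot> K') = q \<odot> (q \<odot> (K \<odot> K'))"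
        using q K(1) K'(1) B.closed by (simp add: B.times_ac)
      also have "\<dots> \<sqsubseteq> \<e> \<odot> (q \<odot> (K \<odot> K'))"
        using q qe K(1) K'(1) B.closed by (intro B.times_mono) auto
      also have "\<dots> = q \<odot> (K \<odot> K')" using q cl B.closed by (simp add: B.unit_times)
      finally have "(q \<odot> K) \<odot> (q \<odot> K') \<sqsubseteq> w" using mix q K(1) K'(1) B.closed by auto
      then have "q \<odot> K' \<sqsubseteq> (q \<odot> K) \<rightharpoonup> w"
        using q w K(1) K'(1) B.closed by (simp add: B.residuation)
      moreover have "join_generator B h b \<sqsubseteq> (q \<odot> K) \<rightharpoonup> w" if b: "b \<in> monomials A L t" for b
      proof -
        have "(q \<odot> K) \<odot> join_generator B h b = q \<odot> (K \<odot> join_generator B h b)"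
          using q K(1) gt[OF b] by (simp add: B.times_assoc)
        also have "\<dots> \<sqsubseteq> q \<odot> (K \<odot> K')"
          using b gt[OF b] q K K' B.closed by (intro B.times_mono) auto
        finally have "(q \<odot> K) \<odot> join_generator B h b \<sqsubseteq> w"
          using mix gt[OF b] q K(1) B.closed by auto
        then show ?thesis using q w K(1) gt[OF b] B.closed by (simp add: B.residuation)
      qed
      ultimately show ?thesis using K'(3) q qe w K(1) B.closed by auto
    qed
    \<comment> \<open>After swapping, the two bounds on \<open>?t\<close> are the hypotheses on
      \<open>s\<close> for the bound \<open>?t \<rightharpoonup> w\<close>.\<close>
    have "join_generator B h a \<sqsubseteq> ?t \<rightharpoonup> w" if a: "a \<in> monomials A L s" for a
      using t_le[OF a] gs[OF a] ec w B.residual_swap[of "join_generator B h a" ?t w] by simp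
    moreover have "q \<odot> K \<sqsubseteq> ?t \<rightharpoonup> w"
      using t_le' q K(1) ec w B.closed B.residual_swap[of "q \<odot> K" ?t w] by simp
    ultimately have "?s \<sqsubseteq> ?t \<rightharpoonup> w"
      using K(3) q qe w ec B.closed by auto
    then show "eval B (approx L q) (Times s t) \<sqsubseteq> w"
      using ec w by (simp add: B.residuation_flip)
  qed
qed

text \<open>One \<open>q\<close> has to serve finitely many terms and bounds. The meet of
  \<open>\<e>\<close> and the residuals \<open>K (r x) \<rightharpoonup> w x\<close> is small enough
  for all of them.\<close>

lemma exists_eval_approx:
  assumes fin: "\<And>i. finite (L i)" and L: "\<And>i. L i \<subseteq> pairs"
    and C: "finite C" "\<And>x. x \<in> C \<Longrightarrow> w x \<in> carrier B"
  obtains q where "q \<in> carrier B"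
    and "\<And>x. \<lbrakk>x \<in> C; \<And>p. p \<in> monomials A L (r x) \<Longrightarrow> join_generator B h p \<sqsubseteq> w x\<rbrakk>
      \<Longrightarrow> eval B (approx L q) (r x) \<sqsubseteq> w x"
proof -
  let ?P = "\<lambda>t K. \<forall>q\<in>carrier B. \<forall>w\<in>carrier B. q \<sqsubseteq> \<e> \<longrightarrow>
    (\<forall>p\<in>monomials A L t. join_generator B h p \<sqsubseteq> w) \<longrightarrow>
    q \<odot> K \<sqsubseteq> w \<longrightarrow> eval B (approx L q) t \<sqsubseteq> w"
  have bound: "\<exists>K. K \<in> carrier B \<and> ?P t K" for t
    using eval_approx_bound[of L t, OF fin L] by blast
  obtain K where K: "K t \<in> carrier B"
    "\<And>q w. \<lbrakk>q \<in> carrier B; w \<in> carrier B; q \<sqsubseteq> \<e>; \<forall>p\<in>monomials A L t. join_generator B h p \<sqsubseteq> w;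
      q \<odot> K t \<sqsubseteq> w\<rbrakk> \<Longrightarrow> eval B (approx L q) t \<sqsubseteq> w" for t
    using that[of "\<lambda>t. SOME K. K \<in> carrier B \<and> ?P t K"] someI_ex[OF bound] by blast
  let ?S = "insert \<e> ((\<lambda>x. K (r x) \<rightharpoonup> w x) ` C)"
  have sub: "?S \<subseteq> carrier B" using C(2) K(1) B.closed by auto
  have "greatest B (\<Sqinter>?S) (Lower B ?S)"
    using C(1) sub by (intro B.finite_inf_greatest) auto
  then have q: "\<Sqinter>?S \<in> carrier B" "\<And>x. x \<in> ?S \<Longrightarrow> \<Sqinter>?S \<sqsubseteq> x"
    using greatest_Lower_below[OF _ _ sub] by auto
  have "eval B (approx L (\<Sqinter>?S)) (r x) \<sqsubseteq> w x"
    if x: "x \<in> C" and le: "\<And>p. p \<in> monomials A L (r x) \<Longrightarrow> join_generator B h p \<sqsubseteq> w x" for x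
  proof -
    have "\<Sqinter>?S \<sqsubseteq> K (r x) \<rightharpoonup> w x" using x by (intro q(2)) blast
    then have "\<Sqinter>?S \<odot> K (r x) \<sqsubseteq> w x" using q(1) K(1) C(2)[OF x] by (simp add: B.residuation_flip)
    then show ?thesis using K(2) q C(2)[OF x] le by auto
  qed
  then show ?thesis using q(1) that by blast
qed

section \<open>Consequences of density\<close>

lemma le_if_join_generators:
  assumes jd: "join_dense B (join_generator B h ` pairs)"
    and x: "x \<in> carrier B" and w: "w \<in> carrier B"
    and le: "\<And>p. \<lbrakk>p \<in> pairs; join_generator B h p \<sqsubseteq> x\<rbrakk> \<Longrightarrow> join_generator B h p \<sqsubseteq> w"
  shows "x \<sqsubseteq> w"
proof -
  obtain S where S: "S \<subseteq> join_generator B h ` pairs" and lub: "least B x (Upper B S)"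
    using jd x unfolding join_dense_def by meson
  have sub: "S \<subseteq> carrier B" using S join_generator_closed by blast
  have "s \<sqsubseteq> w" if "s \<in> S" for s
    using S le least_Upper_above[OF lub that sub] that by blast
  then have "w \<in> Upper B S" using w by (auto simp: Upper_def)
  then show ?thesis using lub least_le by metis
qed

lemma le_if_meet_generators:
  assumes md: "meet_dense B (meet_generator B h ` pairs)"
    and x: "x \<in> carrier B" and w: "w \<in> carrier B"
    and le: "\<And>p. \<lbrakk>p \<in> pairs; x \<sqsubseteq> meet_generator B h p\<rbrakk> \<Longrightarrow> w \<sqsubseteq> meet_generator B h p"
  shows "w \<sqsubseteq> x"
proof -
  obtain S where S: "S \<subseteq> meet_generator B h ` pairs" and glb: "greatest B x (Lower B S)"
    using md x unfolding meet_dense_def by meson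
  have sub: "S \<subseteq> carrier B" using S meet_generator_closed by blast
  have "w \<sqsubseteq> s" if "s \<in> S" for s
    using S le greatest_Lower_below[OF glb that sub] that by blast
  then have "w \<in> Lower B S" using w by (auto simp: Lower_def)
  then show ?thesis using glb greatest_le by metis
qed

text \<open>By density each variable is the join of the generators below it, and residuation makes
  products distribute over such joins: one factor is fixed and moved into the bound, then the roles
  are swapped.\<close>

lemma eval_le_if_monomials_le:
  assumes jd: "join_dense B (join_generator B h ` pairs)" and v: "range v \<subseteq> carrier B"
  shows "\<lbrakk>w \<in> carrier B;
      \<forall>p\<in>monomials A (\<lambda>i. {p \<in> pairs. join_generator B h p \<sqsubseteq> v i}) t. join_generator B h p \<sqsubseteq> w\<rbrakk>
    \<Longrightarrow> eval B v t \<sqsubseteq> w"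
proof (induction t arbitrary: w)
  case (Var i)
  moreover have "v i \<in> carrier B" using v by blast
  ultimately show ?case using le_if_join_generators[OF jd, of "v i" w] by auto
next
  case One
  then show ?case by (simp add: join_generator_unit)
next
  case (Join s t)
  then show ?case using B.eval_closed[OF v] by (auto intro!: B.join_le)
next
  case (Times s t)
  let ?M = "monomials A (\<lambda>i. {p \<in> pairs. join_generator B h p \<sqsubseteq> v i})"
  have M: "?M t \<subseteq> pairs" for t by (rule monomials_closed) blast
  note ec = B.eval_closed[OF v] and w = Times.prems(1)
  have "join_generator B h a \<sqsubseteq> eval B v t \<rightharpoonup> w" if a: "a \<in> ?M s" for a
  proof -
    have ac: "a \<in> pairs" "join_generator B h a \<in> carrier B"
      using a M join_generator_closed by blast+
    have "join_generator B h b \<sqsubseteq> join_generator B h a \<rightharpoonup> w" if b: "b \<in> ?M t" for b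
    proof -
      have bc: "b \<in> pairs" "join_generator B h b \<in> carrier B"
        using b M join_generator_closed by blast+
      have "(fst a \<odot>\<^bsub>A\<^esub> fst b, snd a \<oplus>\<^bsub>A\<^esub> snd b) \<in> ?M (Times s t)"
        using a b by force
      from bspec[OF Times.prems(2) this] have "join_generator B h a \<odot> join_generator B h b \<sqsubseteq> w"
        by (simp only: join_generator_times[OF ac(1) bc(1)])
      then show ?thesis using ac bc w by (simp add: B.residuation)
    qed
    then have "eval B v t \<sqsubseteq> join_generator B h a \<rightharpoonup> w"
      using Times.IH(2) ac w B.closed by simp
    then show ?thesis using B.residual_swap[of "eval B v t" "join_generator B h a" w] ac ec w by simp
  qed
  then have "eval B v s \<sqsubseteq> eval B v t \<rightharpoonup> w"
    using Times.IH(1) ec w B.closed by simp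
  then show ?case using ec w by (simp add: B.residuation_flip)
qed

text \<open>A certificate that \<open>s \<le> t\<close> fails under \<open>v\<close>. Its data
  \<open>M\<close>, \<open>p\<close>, \<open>c\<close> consist of elements of \<open>A\<close>, so
  they can be reread in another lattice containing \<open>A\<close>.\<close>

definition separates ::
  "(nat \<Rightarrow> 'b) \<Rightarrow> tm \<Rightarrow> tm \<Rightarrow> (nat \<Rightarrow> ('a \<times> 'a) set) \<Rightarrow> 'a \<times> 'a \<Rightarrow> 'a \<times> 'a \<Rightarrow> bool" where
  "separates v s t M p c \<longleftrightarrow>
    (\<forall>i. finite (M i) \<and> M i \<subseteq> {p \<in> pairs. join_generator B h p \<sqsubseteq> v i}) \<and>
    p \<in> monomials A M s \<and> c \<in> pairs \<and>
    \<not> join_generator B h p \<sqsubseteq> meet_generator B h c \<and> eval B v t \<sqsubseteq> meet_generator B h c"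

text \<open>Join density yields a monomial of \<open>s\<close> not below the value of
  \<open>t\<close>, meet density a generator separating the two, and compactness the finite
  sets.\<close>

lemma exists_separates:
  assumes jd: "join_dense B (join_generator B h ` pairs)"
    and md: "meet_dense B (meet_generator B h ` pairs)"
    and v: "range v \<subseteq> carrier B" and nle: "\<not> eval B v s \<sqsubseteq> eval B v t"
  shows "\<exists>M p c. separates v s t M p c"
proof -
  let ?L = "\<lambda>i. {p \<in> pairs. join_generator B h p \<sqsubseteq> v i}"
  note ec = B.eval_closed[OF v]
  obtain p where p: "p \<in> monomials A ?L s" "\<not> join_generator B h p \<sqsubseteq> eval B v t"
    using eval_le_if_monomials_le[OF jd v ec] nle by blast
  have "monomials A ?L s \<subseteq> pairs" by (rule monomials_closed) blast
  then have pc: "join_generator B h p \<in> carrier B" using p(1) join_generator_closed by blast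
  obtain c where "c \<in> pairs" "eval B v t \<sqsubseteq> meet_generator B h c"
      "\<not> join_generator B h p \<sqsubseteq> meet_generator B h c"
    using le_if_meet_generators[OF md ec pc] p(2) by blast
  moreover obtain M where "\<forall>i. finite (M i) \<and> M i \<subseteq> ?L i" "p \<in> monomials A M s"
    using monomials_compact[OF p(1)] by blast
  ultimately have "separates v s t M p c" unfolding separates_def by blast
  then show ?thesis by blast
qed

text \<open>The inequality h (a \<or> b) \<le> h a \<or> h b is tested against generators c + \<not>
  d. There it becomes (a \<or> b) \<cdot> d \<le> c + 0, which follows from distributivity in
  \<open>A\<close>. Meets are dual, with join generators and the distributivity of the sum.\<close>

lemma lbimonoid_embedding_if_dense:
  assumes jd: "join_dense B (join_generator B h ` pairs)"
    and md: "meet_dense B (meet_generator B h ` pairs)"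
  shows "lbimonoid_embedding A (lbimonoid_reduct B) h"
proof -
  have join: "h (a \<squnion>\<^bsub>A\<^esub> b) = h a \<squnion> h b" if a: "a \<in> carrier A" and b: "b \<in> carrier A" for a b
  proof (rule B.le_antisym)
    note cl = a b h_closed[OF a] h_closed[OF b] A.closed
    have ab: "h (a \<squnion>\<^bsub>A\<^esub> b) \<in> carrier B" using cl by (intro h_closed) simp
    show "h a \<squnion> h b \<sqsubseteq> h (a \<squnion>\<^bsub>A\<^esub> b)"
      using cl ab A.join_left[OF a b] A.join_right[OF a b]
      by (intro B.join_le) (simp_all add: h_le_iff)
    show "h (a \<squnion>\<^bsub>A\<^esub> b) \<sqsubseteq> h a \<squnion> h b"
    proof (rule le_if_meet_generators[OF md _ ab])
      fix p assume p: "p \<in> pairs" and le: "h a \<squnion> h b \<sqsubseteq> meet_generator B h p"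
      obtain c d where cd: "p = (c, d)" "c \<in> carrier A" "d \<in> carrier A" using p by auto
      have "h a \<sqsubseteq> meet_generator B h p" "h b \<sqsubseteq> meet_generator B h p"
        using le B.join_left B.join_right cl meet_generator_closed[OF p]
        by (metis B.join_closed B.le_trans)+
      then have "a \<odot>\<^bsub>A\<^esub> d \<sqsubseteq>\<^bsub>A\<^esub> c \<oplus>\<^bsub>A\<^esub> \<o>\<^bsub>A\<^esub>" "b \<odot>\<^bsub>A\<^esub> d \<sqsubseteq>\<^bsub>A\<^esub> c \<oplus>\<^bsub>A\<^esub> \<o>\<^bsub>A\<^esub>"
        using cd cl generator_le_iff[of _ "\<o>\<^bsub>A\<^esub>" c d] by (simp_all add: join_generator_zero)
      then have "(d \<odot>\<^bsub>A\<^esub> a) \<squnion>\<^bsub>A\<^esub> (d \<odot>\<^bsub>A\<^esub> b) \<sqsubseteq>\<^bsub>A\<^esub> c \<oplus>\<^bsub>A\<^esub> \<o>\<^bsub>A\<^esub>"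
        using cd cl by (intro A.join_le) (simp_all add: A.times_comm)
      then have "(a \<squnion>\<^bsub>A\<^esub> b) \<odot>\<^bsub>A\<^esub> d \<sqsubseteq>\<^bsub>A\<^esub> c \<oplus>\<^bsub>A\<^esub> \<o>\<^bsub>A\<^esub>"
        using cd cl by (simp add: A.times_join A.times_comm[of "a \<squnion>\<^bsub>A\<^esub> b" d])
      then show "h (a \<squnion>\<^bsub>A\<^esub> b) \<sqsubseteq> meet_generator B h p"
        using cd cl generator_le_iff[of "a \<squnion>\<^bsub>A\<^esub> b" "\<o>\<^bsub>A\<^esub>" c d] by (simp add: join_generator_zero)
    qed (use cl in simp)
  qed (use a b h_closed in simp_all)
  have meet: "h (a \<sqinter>\<^bsub>A\<^esub> b) = h a \<sqinter> h b" if a: "a \<in> carrier A" and b: "b \<in> carrier A" for a b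
  proof (rule B.le_antisym)
    note cl = a b h_closed[OF a] h_closed[OF b] A.closed
    have ab: "h (a \<sqinter>\<^bsub>A\<^esub> b) \<in> carrier B" using cl by (intro h_closed) simp
    show "h (a \<sqinter>\<^bsub>A\<^esub> b) \<sqsubseteq> h a \<sqinter> h b"
      using cl ab A.meet_left[OF a b] A.meet_right[OF a b]
      by (intro B.meet_le) (simp_all add: h_le_iff)
    show "h a \<sqinter> h b \<sqsubseteq> h (a \<sqinter>\<^bsub>A\<^esub> b)"
    proof (rule le_if_join_generators[OF jd _ ab])
      fix p assume p: "p \<in> pairs" and le: "join_generator B h p \<sqsubseteq> h a \<sqinter> h b"
      obtain c d where cd: "p = (c, d)" "c \<in> carrier A" "d \<in> carrier A" using p by auto
      have "join_generator B h p \<sqsubseteq> h a" "join_generator B h p \<sqsubseteq> h b"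
        using le B.meet_left B.meet_right cl join_generator_closed[OF p]
        by (metis B.meet_closed B.le_trans)+
      then have "c \<odot>\<^bsub>A\<^esub> \<e>\<^bsub>A\<^esub> \<sqsubseteq>\<^bsub>A\<^esub> a \<oplus>\<^bsub>A\<^esub> d" "c \<odot>\<^bsub>A\<^esub> \<e>\<^bsub>A\<^esub> \<sqsubseteq>\<^bsub>A\<^esub> b \<oplus>\<^bsub>A\<^esub> d"
        using cd cl generator_le_iff[of c d _ "\<e>\<^bsub>A\<^esub>"] by (simp_all add: meet_generator_unit)
      then have "c \<odot>\<^bsub>A\<^esub> \<e>\<^bsub>A\<^esub> \<sqsubseteq>\<^bsub>A\<^esub> (d \<oplus>\<^bsub>A\<^esub> a) \<sqinter>\<^bsub>A\<^esub> (d \<oplus>\<^bsub>A\<^esub> b)"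
        using cd cl by (intro A.meet_le) (simp_all add: A.plus_comm)
      then have "c \<odot>\<^bsub>A\<^esub> \<e>\<^bsub>A\<^esub> \<sqsubseteq>\<^bsub>A\<^esub> (a \<sqinter>\<^bsub>A\<^esub> b) \<oplus>\<^bsub>A\<^esub> d"
        using cd cl by (simp add: A.plus_meet A.plus_comm[of "a \<sqinter>\<^bsub>A\<^esub> b" d])
      then show "join_generator B h p \<sqsubseteq> h (a \<sqinter>\<^bsub>A\<^esub> b)"
        using cd cl generator_le_iff[of c d "a \<sqinter>\<^bsub>A\<^esub> b" "\<e>\<^bsub>A\<^esub>"] by (simp add: meet_generator_unit)
    qed (use cl in simp)
  qed (use a b h_closed in simp_all)
  have "inj_on h (carrier A)"
    using h_le_iff A.le_antisym h_closed B.le_refl by (metis inj_onI)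
  then show ?thesis
    using emb join meet unfolding lbimonoid_embedding_def bimonoid_embedding_def by simp
qed

end

section \<open>Transfer of clauses\<close>

text \<open>Density is used in \<open>R\<close> to extract certificates. Comparisons of generators
  depend on \<open>A\<close> alone, so the certificates remain valid in \<open>B\<close>.\<close>

lemma satisfies_transfer:
  assumes R: "bimonoid_embedding_in_res_lattice A R e"
    and B: "bimonoid_embedding_in_res_lattice A B h"
    and jd: "join_dense R (join_generator R e ` (carrier A \<times> carrier A))"
    and md: "meet_dense R (meet_generator R e ` (carrier A \<times> carrier A))"
    and sat: "satisfies B \<pi>"
  shows "satisfies R \<pi>"
proof (rule ccontr)
  interpret R: bimonoid_embedding_in_res_lattice A R e by fact
  interpret B: bimonoid_embedding_in_res_lattice A B h by fact
  assume "\<not> satisfies R \<pi>"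
  then obtain v where v: "range v \<subseteq> carrier R"
    and neq: "\<And>s t. (s, t) \<in> set \<pi> \<Longrightarrow> eval R v s \<noteq> eval R v t"
    unfolding satisfies_def by blast
  \<comment> \<open>An equation fails because one of its two inequations fails; \<open>l\<close> and
    \<open>r\<close> record the orientation that does.\<close>
  have "\<exists>M p c l r. (l = fst x \<and> r = snd x \<or> l = snd x \<and> r = fst x) \<and> R.separates v l r M p c"
    if mem: "x \<in> set \<pi>" for x
  proof -
    have "eval R v (fst x) \<noteq> eval R v (snd x)" using neq[of "fst x" "snd x"] mem by simp
    then consider "\<not> eval R v (fst x) \<sqsubseteq>\<^bsub>R\<^esub> eval R v (snd x)"
      | "\<not> eval R v (snd x) \<sqsubseteq>\<^bsub>R\<^esub> eval R v (fst x)"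
      using R.B.le_antisym[OF _ _ R.B.eval_closed[OF v, of "fst x"]
          R.B.eval_closed[OF v, of "snd x"]]
      by metis
    then show ?thesis
      using R.exists_separates[OF jd md v] by cases metis+
  qed
  then obtain M p c l r where
    lr: "\<And>x. x \<in> set \<pi> \<Longrightarrow> l x = fst x \<and> r x = snd x \<or> l x = snd x \<and> r x = fst x"
    and sep: "\<And>x. x \<in> set \<pi> \<Longrightarrow> R.separates v (l x) (r x) (M x) (p x) (c x)"
    by metis
  have M: "finite (M x i)" "M x i \<subseteq> {p \<in> R.pairs. join_generator R e p \<sqsubseteq>\<^bsub>R\<^esub> v i}"
    and p: "p x \<in> monomials A (M x) (l x)" and c: "c x \<in> R.pairs"
    and pc: "\<not> join_generator R e (p x) \<sqsubseteq>\<^bsub>R\<^esub> meet_generator R e (c x)"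
    and rc: "eval R v (r x) \<sqsubseteq>\<^bsub>R\<^esub> meet_generator R e (c x)" if "x \<in> set \<pi>" for x i
    using sep[OF that] unfolding R.separates_def by blast+
  \<comment> \<open>Uniting the choices for all equations gives a single valuation in
    \<open>B\<close> that is to refute every disjunct; \<open>N i\<close> is finite because the
    clause is a list.\<close>
  define N where "N i = (\<Union>x\<in>set \<pi>. M x i)" for i
  have N: "finite (N i)" "N i \<subseteq> R.pairs" "\<And>p. p \<in> N i \<Longrightarrow> join_generator R e p \<sqsubseteq>\<^bsub>R\<^esub> v i" for i
    using M unfolding N_def by blast+
  have transfer: "join_generator R e a \<sqsubseteq>\<^bsub>R\<^esub> meet_generator R e b
      \<longleftrightarrow> join_generator B h a \<sqsubseteq>\<^bsub>B\<^esub> meet_generator B h b"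
    if "a \<in> R.pairs" "b \<in> R.pairs" for a b
    using that R.generator_le_iff B.generator_le_iff by auto
  have mc: "monomials A N t \<subseteq> R.pairs" for t using N(2) by (rule R.monomials_closed)
  have "meet_generator B h (c x) \<in> carrier B" if "x \<in> set \<pi>" for x
    using c[OF that] by (rule B.meet_generator_closed)
  with B.exists_eval_approx[of N "set \<pi>" "\<lambda>x. meet_generator B h (c x)" r, OF N(1,2) finite_set]
  obtain q where q: "q \<in> carrier B"
    and q_le: "\<And>x. \<lbrakk>x \<in> set \<pi>;
        \<And>p. p \<in> monomials A N (r x) \<Longrightarrow> join_generator B h p \<sqsubseteq>\<^bsub>B\<^esub> meet_generator B h (c x)\<rbrakk>
      \<Longrightarrow> eval B (B.approx N q) (r x) \<sqsubseteq>\<^bsub>B\<^esub> meet_generator B h (c x)"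
    by blast
  have u: "range (B.approx N q) \<subseteq> carrier B" using N(1,2) q by (rule B.approx_closed)
  have "\<exists>(s, t)\<in>set \<pi>. eval B (B.approx N q) s = eval B (B.approx N q) t"
    using sat u unfolding satisfies_def by simp
  then obtain x where x: "x \<in> set \<pi>"
    and "eval B (B.approx N q) (fst x) = eval B (B.approx N q) (snd x)"
    by (auto simp: case_prod_beta)
  then have eq: "eval B (B.approx N q) (l x) = eval B (B.approx N q) (r x)" using lr by metis
  \<comment> \<open>Enlarging \<open>M x\<close> to \<open>N\<close> is harmless: the added
    generators also lie below \<open>v\<close>, so the monomials of \<open>r x\<close> stay below
    the separating generator.\<close>
  have "join_generator B h a \<sqsubseteq>\<^bsub>B\<^esub> meet_generator B h (c x)" if a: "a \<in> monomials A N (r x)" for a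
  proof -
    have ap: "a \<in> R.pairs" using a mc by blast
    have "join_generator R e a \<sqsubseteq>\<^bsub>R\<^esub> eval R v (r x)"
      using N(2) v N(3) a by (rule R.monomial_le_eval)
    then have "join_generator R e a \<sqsubseteq>\<^bsub>R\<^esub> meet_generator R e (c x)"
      using rc[OF x] R.B.le_trans R.join_generator_closed[OF ap] R.meet_generator_closed[OF c[OF x]]
        R.B.eval_closed[OF v] by blast
    then show ?thesis using transfer[OF ap c[OF x]] by simp
  qed
  then have le: "eval B (B.approx N q) (l x) \<sqsubseteq>\<^bsub>B\<^esub> meet_generator B h (c x)"
    using q_le[OF x] eq by simp
  have pN: "p x \<in> monomials A N (l x)"
    using p[OF x] monomials_mono[of "M x" N A "l x"] x unfolding N_def by blast
  then have pp: "p x \<in> R.pairs" using mc by blast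
  have "join_generator B h (p x) \<sqsubseteq>\<^bsub>B\<^esub> eval B (B.approx N q) (l x)"
    using N(2) u B.join_generator_le_approx[OF N(1,2)] pN by (rule B.monomial_le_eval)
  then have "join_generator B h (p x) \<sqsubseteq>\<^bsub>B\<^esub> meet_generator B h (c x)"
    using le B.B.le_trans B.join_generator_closed[OF pp] B.meet_generator_closed[OF c[OF x]]
      B.B.eval_closed[OF u] by blast
  then show False using transfer[OF pp c[OF x]] pc[OF x] by simp
qed

section \<open>Subreducts and the completion as bimonoid embeddings\<close>

lemma bimonoid_embedding_if_lbimonoid_embedding:
  assumes "lattice A" "lattice B" "lbimonoid_embedding A B h"
  shows "bimonoid_embedding A B h"
proof -
  interpret A: lattice A by fact
  interpret B: lattice B by fact
  have h: "h \<in> carrier A \<rightarrow> carrier B" "inj_on h (carrier A)"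
    "\<And>x y. \<lbrakk>x \<in> carrier A; y \<in> carrier A\<rbrakk> \<Longrightarrow> h (x \<squnion>\<^bsub>A\<^esub> y) = h x \<squnion>\<^bsub>B\<^esub> h y"
    using assms(3) by (auto simp: lbimonoid_embedding_def)
  have "h x \<sqsubseteq>\<^bsub>B\<^esub> h y \<longleftrightarrow> x \<sqsubseteq>\<^bsub>A\<^esub> y" if "x \<in> carrier A" "y \<in> carrier A" for x y
  proof -
    \<comment> \<open>Injectivity and preservation of joins make \<open>h\<close> reflect the
      order.\<close>
    have "h x \<sqsubseteq>\<^bsub>B\<^esub> h y \<longleftrightarrow> h (x \<squnion>\<^bsub>A\<^esub> y) = h y"
      using B.le_iff_meet[of "h x" "h y"] h that by auto
    also have "\<dots> \<longleftrightarrow> x \<squnion>\<^bsub>A\<^esub> y = y"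
      using h(2) that by (auto simp: inj_on_eq_iff)
    finally show ?thesis using A.le_iff_meet that by simp
  qed
  then have "order_emb A B h"
    unfolding order_emb_def
    using A.weak_partial_order_axioms B.weak_partial_order_axioms by blast
  then show ?thesis
    using assms(3) unfolding bimonoid_embedding_def lbimonoid_embedding_def by simp
qed

lemma lattice_lbimonoid_reduct: "lattice B \<Longrightarrow> lattice (lbimonoid_reduct B)"
  by (rule lattice_cong) (simp_all add: lbimonoid_reduct_def)

lemma bimonoid_embedding_in_res_lattice_if_subreduct:
  assumes "comm_lbimonoid A" "comm_inv_res_lattice B" "subreduct A B"
  obtains h where "bimonoid_embedding_in_res_lattice A B h"
proof -
  obtain h where h: "lbimonoid_embedding A (lbimonoid_reduct B) h"
    using assms(3) by (auto simp: subreduct_def)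
  have "bimonoid_embedding A (lbimonoid_reduct B) h"
    using comm_lbimonoid.axioms(1)[OF assms(1)] comm_inv_res_lattice.axioms(1)[OF assms(2)] h
    by (intro bimonoid_embedding_if_lbimonoid_embedding lattice_lbimonoid_reduct)
  then show ?thesis
    using assms that by (simp add: bimonoid_embedding_in_res_lattice_def
        bimonoid_embedding_in_res_lattice_axioms_def)
qed

text \<open>Negation in \<open>res_lattice_of D\<close> is \<open>compl D\<close> and the rebuilt
  sum is that of \<open>D\<close>, so the dense sets in the definition are the sets of
  generators.\<close>

lemma complemented_DM_completion_res_lattice:
  assumes A: "comm_lbimonoid A" and D: "complemented_DM_completion A D e"
  shows "bimonoid_embedding_in_res_lattice A (res_lattice_of D) e"
    and "join_dense (res_lattice_of D)
      (join_generator (res_lattice_of D) e ` (carrier A \<times> carrier A))"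
    and "meet_dense (res_lattice_of D)
      (meet_generator (res_lattice_of D) e ` (carrier A \<times> carrier A))"
proof -
  let ?R = "res_lattice_of D"
  interpret D: complete_complemented_comm_lbimonoid D
    using D by (simp add: complemented_DM_completion_def)
  have emb: "bimonoid_embedding A D e" using D by (simp add: complemented_DM_completion_def)
  then have e: "\<And>a. a \<in> carrier A \<Longrightarrow> e a \<in> carrier D" by (auto simp: bimonoid_embedding_def)
  have red: "carrier (lbimonoid_reduct ?R) = carrier D" "le (lbimonoid_reduct ?R) = le D"
    "times (lbimonoid_reduct ?R) = times D" "unit (lbimonoid_reduct ?R) = unit D"
    "zero (lbimonoid_reduct ?R) = zero D"
    by (simp_all add: lbimonoid_reduct_def res_lattice_of_def)
  interpret R: comm_inv_res_lattice ?R by (rule D.comm_inv_res_lattice_res_lattice_of)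
  interpret RR: lattice "lbimonoid_reduct ?R"
    by (rule lattice_lbimonoid_reduct) (rule R.lattice_axioms)
  have "bimonoid_embedding A (lbimonoid_reduct ?R) e"
    using emb e RR.weak_partial_order_axioms
    by (simp add: bimonoid_embedding_def order_emb_def red D.plus_reduct_res_lattice_of)
  then show "bimonoid_embedding_in_res_lattice A ?R e"
    using A D.comm_inv_res_lattice_res_lattice_of
    by (simp add: bimonoid_embedding_in_res_lattice_def
        bimonoid_embedding_in_res_lattice_axioms_def)
  have jg: "join_generator ?R e (a, b) = e a \<odot>\<^bsub>D\<^esub> compl D (e b)"
    and mg: "meet_generator ?R e (a, b) = e a \<oplus>\<^bsub>D\<^esub> compl D (e b)"
    if "a \<in> carrier A" "b \<in> carrier A" for a b
    using that e
    by (simp_all add: join_generator_def meet_generator_def D.residual_zero_res_lattice_of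
        D.plus_reduct_res_lattice_of D.compl_closed)
      (simp add: res_lattice_of_def)
  have "join_generator ?R e ` (carrier A \<times> carrier A)
      = {e a \<odot>\<^bsub>D\<^esub> compl D (e b) | a b. a \<in> carrier A \<and> b \<in> carrier A}"
    using jg by (force simp: image_iff)
  then show "join_dense ?R (join_generator ?R e ` (carrier A \<times> carrier A))"
    using D by (simp add: complemented_DM_completion_def join_dense_def least_def Upper_def
        res_lattice_of_def)
  have "meet_generator ?R e ` (carrier A \<times> carrier A)
      = {e a \<oplus>\<^bsub>D\<^esub> compl D (e b) | a b. a \<in> carrier A \<and> b \<in> carrier A}"
    using mg by (force simp: image_iff)
  then show "meet_dense ?R (meet_generator ?R e ` (carrier A \<times> carrier A))"
    using D by (simp add: complemented_DM_completion_def meet_dense_def greatest_def Lower_def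
        res_lattice_of_def)
qed

section \<open>The implications between the three conditions\<close>

lemma models_completion_if_subreducts:
  assumes "comm_lbimonoid A" "complemented_DM_completion A D e"
    and "\<forall>\<pi>\<in>\<Gamma>. subreduct_of_model TYPE('b) A {\<pi>}"
  shows "models (res_lattice_of D) \<Gamma>"
  unfolding models_def
proof
  fix \<pi> assume "\<pi> \<in> \<Gamma>"
  \<comment> \<open>Transfer handles one clause at a time, so \<open>B\<close> may vary with
    \<open>\<pi>\<close>.\<close>
  then obtain B :: "'b res_lattice"
    where B: "comm_inv_res_lattice B" "satisfies B \<pi>" "subreduct A B"
    using assms(3) by (auto simp: subreduct_of_model_def models_def)
  note R = complemented_DM_completion_res_lattice[OF assms(1,2)]
  from bimonoid_embedding_in_res_lattice_if_subreduct[OF assms(1) B(1,3)]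
  show "satisfies (res_lattice_of D) \<pi>"
    using satisfies_transfer[OF R(1) _ R(2,3) B(2)] by blast
qed

lemma subreduct_of_model_antimono:
  "\<lbrakk>subreduct_of_model TYPE('b) A \<Gamma>; \<Delta> \<subseteq> \<Gamma>\<rbrakk> \<Longrightarrow> subreduct_of_model TYPE('b) A \<Delta>"
  unfolding subreduct_of_model_def models_def by blast

text \<open>The completion itself is the witness, which places it in the universe
  \<open>'d\<close>.\<close>

lemma subreduct_of_model_completion:
  fixes D :: "'d lbimonoid"
  assumes "comm_lbimonoid A" "complemented_DM_completion A D e"
    and "models (res_lattice_of D) \<Gamma>"
  shows "subreduct_of_model TYPE('d) A \<Gamma>"
proof -
  note R = complemented_DM_completion_res_lattice[OF assms(1,2)]
  interpret R: bimonoid_embedding_in_res_lattice A "res_lattice_of D" e by (rule R(1))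
  have "subreduct A (res_lattice_of D)"
    unfolding subreduct_def using R.lbimonoid_embedding_if_dense[OF R(2,3)] by blast
  then show ?thesis
    unfolding subreduct_of_model_def using assms(3) R.B.comm_inv_res_lattice_axioms by blast
qed

text \<open>A HOL formula cannot quantify over types. The equivalences are therefore stated in the
  universe \<open>'d\<close> of the completion, and the implications towards the completion also for
  an arbitrary universe \<open>'b\<close>.\<close>

theorem mainTheorem16:
  fixes A :: "'a lbimonoid" and D :: "'d lbimonoid" and e :: "'a \<Rightarrow> 'd"
    and \<Gamma> :: "clause set"
  assumes "comm_lbimonoid A"
    and "complemented_DM_completion A D e"
  shows "(models (res_lattice_of D) \<Gamma> \<longleftrightarrow> subreduct_of_model TYPE('d) A \<Gamma>)
    \<and> (models (res_lattice_of D) \<Gamma> \<longleftrightarrow> (\<forall>\<pi>\<in>\<Gamma>. subreduct_of_model TYPE('d) A {\<pi>}))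
    \<and> (subreduct_of_model TYPE('b) A \<Gamma> \<longrightarrow> models (res_lattice_of D) \<Gamma>)
    \<and> ((\<forall>\<pi>\<in>\<Gamma>. subreduct_of_model TYPE('b) A {\<pi>}) \<longrightarrow> models (res_lattice_of D) \<Gamma>)"
proof -
  have single: "\<forall>\<pi>\<in>\<Gamma>. subreduct_of_model TYPE('b) A {\<pi>}" if "subreduct_of_model TYPE('b) A \<Gamma>"
    using subreduct_of_model_antimono[OF that] by blast
  have single': "\<forall>\<pi>\<in>\<Gamma>. subreduct_of_model TYPE('d) A {\<pi>}" if "subreduct_of_model TYPE('d) A \<Gamma>"
    using subreduct_of_model_antimono[OF that] by blast
  show ?thesis
    using single single' subreduct_of_model_completion[OF assms, of \<Gamma>]
      models_completion_if_subreducts[OF assms, of \<Gamma>, where 'b = 'b]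
      models_completion_if_subreducts[OF assms, of \<Gamma>, where 'b = 'd]
    by argo
qed

end
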